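(* Let $q$ be a power of a prime $p$ and let $n\geq 1$. If $F\in\mathcal{N}_{q,n}$ and $$\deg F<p(q+1),$$ then $F$ is extension-exceptional. Equivalently, every map in $\mathcal{N}_{q,n}$ with finite spectrum has degree at least $p(q+1)$. For every $n\geq 2$, the bound is attained by the map $$F_{q,1,n}(X_1,\ldots,X_n)=\left(X_1+\bigl(X_2(X_1^q-X_1)\bigr)^{p},X_2,\ldots,X_n\right),$$ whose spectrum is $\{1\}$.
   Context: $\mathcal{N}_{q,n}$ is the class of polynomial maps $F\in\mathbf{F}_q[X_1,\ldots,X_n]^n$ whose Jacobian matrix $(\partial F_i/\partial X_j)$ equals the identity matrix $I_n$ (as a matrix of polynomials) and which induce the identity function on $\mathbf{F}_q^n$. The spectrum of $F$ is $\mathcal{S}_q(F)=\{m\in\mathbf{N}_{>0}: F\colon\mathbf{F}_{q^m}^n\to\mathbf{F}_{q^m}^n\text{ is bijective}\}$, and $F$ is extension-exceptional if $\mathcal{S}_q(F)$ is infinite. For a polynomial map $F$, $\deg F$ denotes the maximum of the total degrees of its coordinate polynomials. *)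

theory Defs
  imports
    "HOL-Library.Poly_Mapping"
    "HOL-Library.FuncSet"
    "HOL-Library.Cardinality"
    "HOL-Number_Theory.Residues"
    "HOL-Algebra.Algebraic_Closure_Type"
begin

hide_const (open) Divisibility.prime

text \<open>
  Multivariate polynomials are finitely supported maps from monomials (exponent vectors) to
  coefficients; the ring structure is the convolution product of \<^theory>\<open>HOL-Library.Poly_Mapping\<close>.
  Variables are indexed by natural numbers, and $X_1, \ldots, X_n$ are the variables with index
  in \<open>{1..n}\<close>.
\<close>

type_synonym monomial = "nat \<Rightarrow>\<^sub>0 nat"
type_synonym 'a mpoly = "monomial \<Rightarrow>\<^sub>0 'a"

definition Var :: "nat \<Rightarrow> 'a::comm_ring_1 mpoly" where
  "Var i = Poly_Mapping.single (Poly_Mapping.single i 1) 1"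

definition polys_in :: "nat \<Rightarrow> 'a::comm_ring_1 mpoly set" where
  "polys_in n = {P. \<forall>m \<in> Poly_Mapping.keys P. Poly_Mapping.keys m \<subseteq> {1..n}}"

definition monomial_degree :: "monomial \<Rightarrow> nat" where
  "monomial_degree m = (\<Sum>i \<in> Poly_Mapping.keys m. Poly_Mapping.lookup m i)"

text \<open>The total degree of the zero polynomial is 0 by convention.\<close>

definition total_degree :: "'a::comm_ring_1 mpoly \<Rightarrow> nat" where
  "total_degree P = Max (insert 0 (monomial_degree ` Poly_Mapping.keys P))"

text \<open>If \<open>X\<^sub>j\<close> does not occur in \<open>m\<close>, the truncated exponent is harmless as the coefficient is 0.\<close>

definition partial_deriv :: "nat \<Rightarrow> 'a::comm_ring_1 mpoly \<Rightarrow> 'a mpoly" where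
  "partial_deriv j P = (\<Sum>m \<in> Poly_Mapping.keys P.
     Poly_Mapping.single (m - Poly_Mapping.single j 1)
       (of_nat (Poly_Mapping.lookup m j) * Poly_Mapping.lookup P m))"

definition eval_mpoly :: "(nat \<Rightarrow> 'a::comm_ring_1) \<Rightarrow> 'a mpoly \<Rightarrow> 'a" where
  "eval_mpoly x P = (\<Sum>m \<in> Poly_Mapping.keys P.
     Poly_Mapping.lookup P m * (\<Prod>i \<in> Poly_Mapping.keys m. x i ^ Poly_Mapping.lookup m i))"

text \<open>
  Points of $K^n$ are the elements of \<open>{1..n} \<rightarrow>\<^sub>E K\<close>, i.e. functions on \<open>{1..n}\<close> (canonically
  extended by \<open>undefined\<close>), and similarly for \<open>n\<close>-tuples of polynomials.
\<close>

definition poly_maps :: "nat \<Rightarrow> (nat \<Rightarrow> 'a::comm_ring_1 mpoly) set" where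
  "poly_maps n = {1..n} \<rightarrow>\<^sub>E polys_in n"

definition eval_map :: "nat \<Rightarrow> (nat \<Rightarrow> 'a::comm_ring_1 mpoly) \<Rightarrow> (nat \<Rightarrow> 'a) \<Rightarrow> (nat \<Rightarrow> 'a)" where
  "eval_map n F x = (\<lambda>i \<in> {1..n}. eval_mpoly x (F i))"

definition map_degree :: "nat \<Rightarrow> (nat \<Rightarrow> 'a::comm_ring_1 mpoly) \<Rightarrow> nat" where
  "map_degree n F = Max ((\<lambda>i. total_degree (F i)) ` {1..n})"

definition jacobian :: "(nat \<Rightarrow> 'a::comm_ring_1 mpoly) \<Rightarrow> nat \<Rightarrow> nat \<Rightarrow> 'a mpoly" where
  "jacobian F i j = partial_deriv j (F i)"

text \<open>The class $\mathcal{N}_{q,n}$, where the type \<open>'a\<close> is the field with $q$ elements.\<close>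

definition N_class :: "nat \<Rightarrow> (nat \<Rightarrow> 'a::finite_field mpoly) set" where
  "N_class n = {F \<in> poly_maps n.
     (\<forall>i \<in> {1..n}. \<forall>j \<in> {1..n}. jacobian F i j = (if i = j then 1 else 0)) \<and>
     (\<forall>x \<in> {1..n} \<rightarrow>\<^sub>E UNIV. eval_map n F x = x)}"

text \<open>
  For a field \<open>'a\<close> with $q$ elements, the field with $q^m$ elements, realised as the unique
  subfield of that cardinality of the algebraic closure of \<open>'a\<close>: the set of fixed points of the
  $m$-th power of the $q$-Frobenius.  The lemmas below establish that, for \<open>m > 0\<close>, it is a
  subfield with $q^m$ elements that contains \<open>'a\<close>.
\<close>

definition ext_field :: "nat \<Rightarrow> 'a::finite_field alg_closure set" where
  "ext_field m = {x. x ^ (CARD('a) ^ m) = x}"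

definition extend_scalars ::
    "(nat \<Rightarrow> 'a::finite_field mpoly) \<Rightarrow> (nat \<Rightarrow> 'a alg_closure mpoly)" where
  "extend_scalars F i = Poly_Mapping.map to_ac (F i)"

definition spectrum :: "nat \<Rightarrow> (nat \<Rightarrow> 'a::finite_field mpoly) \<Rightarrow> nat set" where
  "spectrum n F = {m. m > 0 \<and>
     bij_betw (eval_map n (extend_scalars F)) ({1..n} \<rightarrow>\<^sub>E ext_field m) ({1..n} \<rightarrow>\<^sub>E ext_field m)}"

definition extension_exceptional :: "nat \<Rightarrow> (nat \<Rightarrow> 'a::finite_field mpoly) \<Rightarrow> bool" where
  "extension_exceptional n F \<longleftrightarrow> infinite (spectrum n F)"

text \<open>The map $F_{q,1,n}$ in characteristic $p$ (only meaningful for \<open>n \<ge> 2\<close>).\<close>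

definition extremal_map :: "nat \<Rightarrow> nat \<Rightarrow> nat \<Rightarrow> (nat \<Rightarrow> 'a::comm_ring_1 mpoly)" where
  "extremal_map p q n = (\<lambda>i \<in> {1..n}.
     if i = 1 then Var 1 + (Var 2 * (Var 1 ^ q - Var 1)) ^ p else Var i)"

lemma to_ac_in_ext_field: "to_ac x \<in> ext_field m" for x :: "'a::finite_field"
proof -
  have "x ^ (CARD('a) ^ m) = x"
    by (induction m) (simp_all add: power_mult finite_field_power_card_eq_same)
  thus ?thesis
    unfolding ext_field_def by (simp flip: to_ac_power)
qed

lemma ext_field_0: "0 \<in> ext_field m" and ext_field_1: "1 \<in> ext_field m"
  by (simp_all add: ext_field_def)

lemma ext_field_mult: "x \<in> ext_field m \<Longrightarrow> y \<in> ext_field m \<Longrightarrow> x * y \<in> ext_field m"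
  by (simp add: ext_field_def power_mult_distrib)

lemma ext_field_inverse: "x \<in> ext_field m \<Longrightarrow> inverse x \<in> ext_field m"
  by (simp add: ext_field_def power_inverse)

lemma CHAR_eq_of_CARD:
  assumes "prime p" "CARD('a::finite_field) = p ^ e"
  shows "CHAR('a) = p"
proof -
  have "CHAR('a) dvd p ^ e"
    using CHAR_dvd_CARD[where ?'a = 'a] assms(2) by simp
  moreover have "prime CHAR('a)" by simp
  ultimately show ?thesis
    using assms(1) primes_dvd_imp_eq prime_dvd_power by blast
qed

lemma ext_field_diff:
  fixes x y :: "'a::finite_field alg_closure"
  assumes "prime p" "CARD('a) = p ^ e" "x \<in> ext_field m" "y \<in> ext_field m"
  shows "x - y \<in> ext_field m"
proof -
  have char: "CHAR('a alg_closure) = p"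
    using CHAR_eq_of_CARD[OF assms(1,2)] by simp
  have "(x - y + y) ^ (CARD('a) ^ m) = (x - y) ^ (CARD('a) ^ m) + y ^ (CARD('a) ^ m)"
    by (rule freshmans_dream'[where n = "e * m"]) (use assms char in \<open>simp_all add: power_mult\<close>)
  thus ?thesis
    using assms(3,4) by (simp add: ext_field_def algebra_simps)
qed

lemma card_ext_field:
  assumes "m > 0"
  shows "card (ext_field m :: 'a::finite_field alg_closure set) = CARD('a) ^ m"
proof -
  define N where "N = CARD('a) ^ m"
  have "card {0, 1 :: 'a} \<le> CARD('a)"
    by (rule card_mono) auto
  hence "CARD('a) > 1" by simp
  hence N: "N > 1"
    unfolding N_def using assms by (rule one_less_power)
  have "CHAR('a) dvd N"
    unfolding N_def using CHAR_dvd_CARD[where ?'a = 'a] assms by (simp add: dvd_power_same dvd_trans)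
  hence N0: "of_nat N = (0 :: 'a alg_closure)"
    by (simp add: of_nat_eq_0_iff_char_dvd)
  define P :: "'a alg_closure poly" where "P = monom 1 N - monom 1 1"
  have poly_P: "poly P x = x ^ N - x" for x
    by (simp add: P_def poly_monom)
  have deg: "degree P = N"
    unfolding P_def using N degree_add_eq_left[of "- monom (1 :: 'a alg_closure) 1" "monom 1 N"]
    by (simp add: degree_monom_eq)
  have pderiv_P: "pderiv P = -1"
    by (simp add: P_def pderiv_diff pderiv_monom N0)
  have "P \<noteq> 0" using deg N by auto
  then obtain A where A: "size A = N" "P = smult (lead_coeff P) (\<Prod>x\<in>#A. [:-x, 1:])"
    using alg_closed_imp_factorization[of P] deg by auto
  have "proots (\<Prod>x\<in>#A. [:-x, 1:]) = A" for A :: "'a alg_closure multiset"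
    by (induction A) (simp_all add: proots_mult prod_mset_zero_iff image_iff del: mult_pCons_left)
  hence "proots P = A"
    using \<open>P \<noteq> 0\<close> by (subst A(2)) simp
  have count: "count A x \<le> 1" for x
  proof (rule ccontr)
    assume "\<not> count A x \<le> 1"
    hence "order x P \<ge> 2"
      using \<open>proots P = A\<close> \<open>P \<noteq> 0\<close> count_proots[of P x] by simp
    hence "[:-x, 1:] ^ 2 dvd P"
      by (simp add: order_divides)
    then obtain R where "P = [:-x, 1:] ^ 2 * R"
      by (elim dvdE)
    hence "P = [:-x, 1:] * ([:-x, 1:] * R)"
      by (simp only: power2_eq_square mult.assoc)
    moreover have "poly (pderiv ([:-x, 1:] * ([:-x, 1:] * R))) x = 0"
      by (simp add: pderiv_mult del: mult_pCons_left)
    ultimately have "poly (pderiv P) x = 0"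
      by (rule ssubst)
    thus False
      by (simp add: pderiv_P)
  qed
  have "count A x = 1" if "x \<in># A" for x
    using count[of x] that by (simp flip: count_greater_zero_iff)
  hence "card (set_mset A) = size A"
    by (simp add: size_multiset_overloaded_eq)
  moreover have "set_mset A = ext_field m"
    using \<open>proots P = A\<close> \<open>P \<noteq> 0\<close> set_count_proots[of P]
    by (auto simp: ext_field_def poly_P N_def)
  ultimately show ?thesis using A(1) N_def by simp
qed

end

(*
  A map F in the class has coordinates X_i + H_i where every exponent in H_i is divisible by p
  and H_i vanishes on F_q^n.  If deg F < p (q + 1), this forces
  H_i = sum_j b_ij (X_j^(pq) - X_j^p), so F is additive.  With phi the q-Frobenius, sigma the
  p-Frobenius and B = (b_ij) this reads F = 1 + B sigma (phi - 1).  On the field with q^(p^r)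
  elements, (phi - 1)^(p^r) = phi^(p^r) - 1 = 0, and phi - 1 commutes with B and sigma, hence F is
  unipotent there.  So every p^r lies in the spectrum.

  For the extremal map over the field with q^m elements, m > 1, take u with u^q <> u.  A suitable
  p-th root t makes the first coordinate of the image of (u, t, 0, ..., 0) vanish, so this point
  has the same image as (0, t, 0, ..., 0).
*)
theory Submission
  imports Defs
begin

section \<open>Reduced polynomials that vanish on a finite field\<close>

text \<open>Induction on the set of variables. With the old variables fixed, the sum is a univariate
  polynomial in the new one, of degree below \<open>CARD('a)\<close> but with every field element as
  a root. Its coefficients therefore vanish, and they are sums of the same kind in one variable
  fewer.\<close>

lemma reduced_vanishing_imp_zero:
  fixes c :: "('i \<Rightarrow> nat) \<Rightarrow> 'a::finite_field"
  assumes "finite I"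
    and "\<And>y. (\<Sum>f \<in> I \<rightarrow>\<^sub>E {..<CARD('a)}. c f * (\<Prod>i\<in>I. y i ^ f i)) = 0"
    and "f \<in> I \<rightarrow>\<^sub>E {..<CARD('a)}"
  shows "c f = 0"
  using assms
proof (induction I arbitrary: c f rule: finite_induct)
  case empty
  then show ?case by simp
next
  case (insert j I)
  define Q where "Q = CARD('a)"
  have Q: "Q > 0" unfolding Q_def by simp
  have vanish: "(\<Sum>g \<in> I \<rightarrow>\<^sub>E {..<Q}. c (g(j := k)) * (\<Prod>i\<in>I. y i ^ g i)) = 0"
    if "k < Q" for y k
  proof -
    define s where "s k = (\<Sum>g \<in> I \<rightarrow>\<^sub>E {..<Q}. c (g(j := k)) * (\<Prod>i\<in>I. y i ^ g i))" for k
    define P where "P = (\<Sum>k<Q. monom (s k) k)"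
    have "poly P t = 0" for t
    proof -
      define y' where "y' = y(j := t)"
      have "0 = (\<Sum>f \<in> insert j I \<rightarrow>\<^sub>E {..<Q}. c f * (\<Prod>i\<in>insert j I. y' i ^ f i))"
        using insert.prems(1) unfolding Q_def by simp
      \<comment> \<open>An exponent vector on \<open>insert j I\<close> is split into its value
        \<open>k\<close> at \<open>j\<close> and its restriction \<open>g\<close> to
        \<open>I\<close>.\<close>
      also have "\<dots> = (\<Sum>(k, g) \<in> {..<Q} \<times> (I \<rightarrow>\<^sub>E {..<Q}).
          c (g(j := k)) * (\<Prod>i\<in>insert j I. y' i ^ (g(j := k)) i))"
        unfolding PiE_insert_eq
        by (subst sum.reindex[OF inj_combinator[OF insert.hyps(2)]]) (simp add: case_prod_unfold)
      also have "\<dots> = (\<Sum>(k, g) \<in> {..<Q} \<times> (I \<rightarrow>\<^sub>E {..<Q}).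
          c (g(j := k)) * (\<Prod>i\<in>I. y i ^ g i) * t ^ k)"
      proof (intro sum.cong refl, clarify)
        fix k g
        have "(\<Prod>i\<in>I. y' i ^ (g(j := k)) i) = (\<Prod>i\<in>I. y i ^ g i)"
          using insert.hyps by (intro prod.cong) (auto simp: y'_def)
        then show "c (g(j := k)) * (\<Prod>i\<in>insert j I. y' i ^ (g(j := k)) i)
            = c (g(j := k)) * (\<Prod>i\<in>I. y i ^ g i) * t ^ k"
          using insert.hyps by (simp add: y'_def)
      qed
      also have "\<dots> = (\<Sum>k<Q. s k * t ^ k)"
        unfolding s_def sum_distrib_right by (rule sum.cartesian_product[symmetric])
      also have "\<dots> = poly P t"
        by (simp add: P_def poly_sum poly_monom)
      finally show ?thesis by simp
    qed
    then have roots: "{t. poly P t = 0} = UNIV" by simp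
    have deg: "degree P < Q"
      unfolding P_def using Q by (intro degree_sum_less) (auto intro: le_less_trans degree_monom_le)
    have "P = 0"
      using card_poly_roots_bound[of P] deg unfolding roots Q_def by linarith
    then have "coeff P k = 0" by simp
    moreover have "coeff P k = s k"
      unfolding P_def using that by (simp add: coeff_sum)
    ultimately show ?thesis unfolding s_def by simp
  qed
  \<comment> \<open>The induction hypothesis is applied to the slice of \<open>c\<close> in which
    the exponent at \<open>j\<close> is frozen at \<open>f j\<close>.\<close>
  have "c ((restrict f I)(j := f j)) = 0"
  proof (rule insert.IH[where c = "\<lambda>g. c (g(j := f j))" and f = "restrict f I"])
    show "(\<Sum>g \<in> I \<rightarrow>\<^sub>E {..<CARD('a)}. c (g(j := f j)) * (\<Prod>i\<in>I. y i ^ g i)) = 0" for y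
      using vanish[of "f j" y] insert.prems(2) unfolding Q_def by (auto simp: PiE_iff)
    show "restrict f I \<in> I \<rightarrow>\<^sub>E {..<CARD('a)}"
      using insert.prems(2) by (auto simp: PiE_iff)
  qed
  moreover have "(restrict f I)(j := f j) = f"
    using insert.prems(2) by (auto simp: fun_eq_iff PiE_iff extensional_def)
  ultimately show ?case by simp
qed

section \<open>Iterates of the Frobenius difference\<close>

text \<open>Additivity is applied to (x - y) + y, which avoids discussing the sign of
  (-1)^p.\<close>

lemma diff_power_prime_power:
  fixes x y :: "'a::comm_ring_1"
  assumes "prime CHAR('a)"
  shows "(x - y) ^ (CHAR('a) ^ k) = x ^ (CHAR('a) ^ k) - y ^ (CHAR('a) ^ k)"
proof -
  have "(x - y + y) ^ (CHAR('a) ^ k) = (x - y) ^ (CHAR('a) ^ k) + y ^ (CHAR('a) ^ k)"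
    by (rule freshmans_dream') (use assms in auto)
  then show ?thesis by simp
qed

text \<open>This is the operator phi - 1, where phi is the q-Frobenius.\<close>

definition frob_diff :: "nat \<Rightarrow> 'a::comm_ring_1 \<Rightarrow> 'a" where
  "frob_diff q u = u ^ q - u"

text \<open>
  Letting a polynomial act with \<open>X\<close> as the \<open>q\<close>-Frobenius turns the identity
  $(X - 1)^{p^r} = X^{p^r} - 1$ of characteristic \<open>p\<close> into the corresponding identity for the
  operator \<open>frob_diff\<close>.
\<close>

definition frob_apply :: "nat \<Rightarrow> 'a::comm_ring_1 poly \<Rightarrow> 'a \<Rightarrow> 'a" where
  "frob_apply q P u = (\<Sum>i\<le>degree P. coeff P i * u ^ (q ^ i))"

text \<open>Padding the sum to a common length allows polynomials of different degrees to be
  compared termwise.\<close>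

lemma frob_apply_altdef:
  "degree P \<le> N \<Longrightarrow> frob_apply q P u = (\<Sum>i\<le>N. coeff P i * u ^ (q ^ i))"
  unfolding frob_apply_def by (rule sum.mono_neutral_left) (auto simp: coeff_eq_0)

text \<open>Since \<open>frob_diff\<close> acts on the argument first, no Frobenius ever hits the
  coefficients of \<open>P\<close>, so these may be arbitrary.\<close>

lemma frob_apply_mult_X_minus_1:
  fixes P :: "'a::comm_ring_1 poly"
  assumes "prime CHAR('a)" "q = CHAR('a) ^ e"
  shows "frob_apply q (P * [:-1, 1:]) u = frob_apply q P (frob_diff q u)"
proof -
  define N where "N = Suc (degree P)"
  have eq: "P * [:-1, 1:] = pCons 0 P - P" by simp
  have "degree (pCons 0 P - P) \<le> N"
    unfolding N_def by (rule degree_diff_le) (auto simp: degree_pCons_le)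
  then have "frob_apply q (P * [:-1, 1:]) u = (\<Sum>i\<le>N. coeff (pCons 0 P - P) i * u ^ (q ^ i))"
    unfolding eq by (rule frob_apply_altdef)
  also have "\<dots> = (\<Sum>i\<le>N. coeff (pCons 0 P) i * u ^ (q ^ i)) - (\<Sum>i\<le>N. coeff P i * u ^ (q ^ i))"
    by (simp add: left_diff_distrib sum_subtractf)
  also have "(\<Sum>i\<le>N. coeff P i * u ^ (q ^ i)) = frob_apply q P u"
    by (rule frob_apply_altdef[symmetric]) (simp add: N_def)
  \<comment> \<open>Multiplication by X shifts the coefficients by one place, and u^(q^(i+1)) =
    (u^q)^(q^i) moves this shift into the argument.\<close>
  also have "(\<Sum>i\<le>N. coeff (pCons 0 P) i * u ^ (q ^ i)) = frob_apply q P (u ^ q)"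
    unfolding N_def frob_apply_def
    by (subst sum.atMost_Suc_shift) (simp add: power_mult)
  also have "frob_apply q P (u ^ q) - frob_apply q P u = frob_apply q P (frob_diff q u)"
    unfolding frob_apply_def frob_diff_def assms(2) power_mult[symmetric]
    by (simp add: diff_power_prime_power[OF assms(1)] power_mult[symmetric]
        right_diff_distrib sum_subtractf)
  finally show ?thesis .
qed

lemma frob_apply_X_minus_1_power:
  fixes u :: "'a::comm_ring_1"
  assumes "prime CHAR('a)" "q = CHAR('a) ^ e"
  shows "frob_apply q ([:-1, 1:] ^ k) u = (frob_diff q ^^ k) u"
proof (induction k arbitrary: u)
  case 0
  show ?case by (simp add: frob_apply_def)
next
  case (Suc k)
  show ?case
    using frob_apply_mult_X_minus_1[OF assms, of "[:-1, 1:] ^ k"] Suc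
    by (simp only: power_Suc2 funpow_Suc_right o_apply)
qed

lemma frob_diff_funpow_prime_power:
  fixes u :: "'a::comm_ring_1"
  assumes "prime CHAR('a)" "q = CHAR('a) ^ e"
  shows "(frob_diff q ^^ (CHAR('a) ^ r)) u = u ^ (q ^ (CHAR('a) ^ r)) - u"
proof -
  let ?N = "CHAR('a) ^ r"
  \<comment> \<open>Additivity of p-power maps is used in the polynomial ring, which has the same
    characteristic as its coefficients.\<close>
  have "(monom (1 :: 'a) 1 - 1) ^ ?N = monom 1 1 ^ ?N - 1"
    using diff_power_prime_power[where 'a = "'a poly", of "monom 1 1" 1 r] assms by simp
  moreover have "monom (1 :: 'a) 1 - 1 = [:-1, 1:]"
    by (simp add: monom_altdef one_pCons)
  ultimately have eq: "[:-1, 1:] ^ ?N = monom (1 :: 'a) ?N - 1"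
    by (simp add: monom_power)
  have N: "?N \<noteq> 0" using assms(1) by (simp add: prime_gt_0_nat)
  have "degree (monom (1 :: 'a) ?N - 1) \<le> ?N"
    by (rule degree_diff_le) (auto simp: degree_monom_le)
  then have "frob_apply q ([:-1, 1:] ^ ?N) u = (\<Sum>i\<le>?N. coeff (monom 1 ?N - 1) i * u ^ (q ^ i))"
    unfolding eq by (rule frob_apply_altdef)
  also have "\<dots> = (\<Sum>i\<le>?N. (if i = ?N then u ^ (q ^ i) else 0) - (if i = 0 then u ^ (q ^ i) else 0))"
    using N by (intro sum.cong) (auto simp: coeff_1)
  also have "\<dots> = u ^ (q ^ ?N) - u"
    by (simp add: sum_subtractf sum.delta)
  finally show ?thesis using frob_apply_X_minus_1_power[OF assms] by simp
qed

section \<open>Evaluation, degree and derivatives of multivariate polynomials\<close>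

text \<open>Over a common finite set containing both supports, additivity of evaluation becomes a
  termwise identity, even if monomials cancel.\<close>

lemma eval_mpoly_superset:
  assumes "finite S" "Poly_Mapping.keys P \<subseteq> S"
  shows "eval_mpoly x P = (\<Sum>m\<in>S. Poly_Mapping.lookup P m *
           (\<Prod>i\<in>Poly_Mapping.keys m. x i ^ Poly_Mapping.lookup m i))"
  unfolding eval_mpoly_def
  by (rule sum.mono_neutral_left) (use assms in \<open>auto simp: in_keys_iff\<close>)

lemma eval_mpoly_add: "eval_mpoly x (P + Q) = eval_mpoly x P + eval_mpoly x Q"
proof -
  let ?S = "Poly_Mapping.keys P \<union> Poly_Mapping.keys Q"
  show ?thesis
    using Poly_Mapping.keys_add[of P Q]
    by (simp add: eval_mpoly_superset[of ?S] lookup_add distrib_right sum.distrib)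
qed

lemma eval_mpoly_single:
  "eval_mpoly x (Poly_Mapping.single m c) =
     c * (\<Prod>i\<in>Poly_Mapping.keys m. x i ^ Poly_Mapping.lookup m i)"
  by (subst eval_mpoly_superset[of "{m}"]) auto

lemma eval_mpoly_diff: "eval_mpoly x (P - Q) = eval_mpoly x P - eval_mpoly x Q"
  using eval_mpoly_add[of x "P - Q" Q] by simp

lemma eval_mpoly_Var: "eval_mpoly x (Var i) = x i"
  by (simp add: Var_def eval_mpoly_single)

lemma prod_powers_superset:
  fixes x :: "nat \<Rightarrow> 'a::comm_ring_1"
  assumes "finite I" "Poly_Mapping.keys m \<subseteq> I"
  shows "(\<Prod>i\<in>Poly_Mapping.keys m. x i ^ Poly_Mapping.lookup m i) = (\<Prod>i\<in>I. x i ^ Poly_Mapping.lookup m i)"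
  by (rule prod.mono_neutral_left) (use assms in \<open>auto simp: in_keys_iff\<close>)

lemma polys_in_keys_subset:
  "P \<in> polys_in n \<Longrightarrow> m \<in> Poly_Mapping.keys P \<Longrightarrow> Poly_Mapping.keys m \<subseteq> {1..n}"
  by (simp add: polys_in_def)

lemma eval_mpoly_cong:
  assumes "P \<in> polys_in n" "\<And>i. i \<in> {1..n} \<Longrightarrow> x i = y i"
  shows "eval_mpoly x P = eval_mpoly y P"
  unfolding eval_mpoly_def
  by (intro sum.cong refl arg_cong2[where f = "(*)"] prod.cong arg_cong2[where f = "(^)"] assms(2))
     (use polys_in_keys_subset[OF assms(1)] in blast)+

lemma polys_in_diff: "P \<in> polys_in n \<Longrightarrow> Q \<in> polys_in n \<Longrightarrow> P - Q \<in> polys_in n"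
  using keys_diff[of P Q] by (fastforce simp: polys_in_def)

lemma Var_in_polys_in: "i \<in> {1..n} \<Longrightarrow> Var i \<in> polys_in n"
  by (simp add: Var_def polys_in_def)

lemma monomial_degree_superset:
  assumes "finite S" "Poly_Mapping.keys m \<subseteq> S"
  shows "monomial_degree m = (\<Sum>i\<in>S. Poly_Mapping.lookup m i)"
  unfolding monomial_degree_def
  by (rule sum.mono_neutral_left) (use assms in \<open>auto simp: in_keys_iff\<close>)

lemma lookup_le_monomial_degree: "Poly_Mapping.lookup m i \<le> monomial_degree m"
proof (cases "i \<in> Poly_Mapping.keys m")
  case True
  then show ?thesis unfolding monomial_degree_def by (intro member_le_sum) auto
qed (simp add: in_keys_iff)

lemma lookup_add_lookup_le_monomial_degree:
  assumes "i \<noteq> j"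
  shows "Poly_Mapping.lookup m i + Poly_Mapping.lookup m j \<le> monomial_degree m"
proof -
  have "sum (Poly_Mapping.lookup m) {i, j} \<le> sum (Poly_Mapping.lookup m) ({i, j} \<union> Poly_Mapping.keys m)"
    by (rule sum_mono2) auto
  then show ?thesis
    using assms by (subst monomial_degree_superset[of "{i, j} \<union> Poly_Mapping.keys m"]) auto
qed

lemma monomial_degree_le_total_degree:
  "m \<in> Poly_Mapping.keys P \<Longrightarrow> monomial_degree m \<le> total_degree P"
  unfolding total_degree_def by (rule Max_ge) auto

lemma total_degree_le_map_degree: "i \<in> {1..n} \<Longrightarrow> total_degree (F i) \<le> map_degree n F"
  unfolding map_degree_def by (rule Max_ge) auto

text \<open>Lowering the exponent of X_j is injective on the monomials in which X_j occurs, and all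
  other monomials contribute 0. Hence nothing cancels in the derivative, and each of its terms
  vanishes separately.\<close>

lemma of_nat_lookup_eq_0:
  assumes "partial_deriv j P = 0" "m \<in> Poly_Mapping.keys P"
  shows "of_nat (Poly_Mapping.lookup m j) * Poly_Mapping.lookup P m = (0 :: 'a::comm_ring_1)"
proof (cases "Poly_Mapping.lookup m j = 0")
  case False
  let ?e = "Poly_Mapping.single j (1 :: nat)"
  have other: "Poly_Mapping.lookup (Poly_Mapping.single (m' - ?e)
          (of_nat (Poly_Mapping.lookup m' j) * Poly_Mapping.lookup P m')) (m - ?e) = 0"
    if "m' \<noteq> m" for m'
  proof (cases "Poly_Mapping.lookup m' j = 0")
    case m': False
    have "m' - ?e \<noteq> m - ?e"
    proof
      assume eq: "m' - ?e = m - ?e"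
      have "Poly_Mapping.lookup m' i = Poly_Mapping.lookup m i" for i
        using arg_cong[OF eq, of "\<lambda>m. Poly_Mapping.lookup m i"] False m'
        by (auto simp: lookup_minus lookup_single when_def split: if_splits)
      then show False using that by (simp add: poly_mapping_eqI)
    qed
    then show ?thesis by (simp add: lookup_single_not_eq)
  qed simp
  have "0 = Poly_Mapping.lookup (partial_deriv j P) (m - ?e)"
    by (simp add: assms(1))
  also have "\<dots> = (\<Sum>m'\<in>Poly_Mapping.keys P. Poly_Mapping.lookup (Poly_Mapping.single (m' - ?e)
          (of_nat (Poly_Mapping.lookup m' j) * Poly_Mapping.lookup P m')) (m - ?e))"
    unfolding partial_deriv_def lookup_sum ..
  also have "\<dots> = (\<Sum>m'\<in>{m}. Poly_Mapping.lookup (Poly_Mapping.single (m' - ?e)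
          (of_nat (Poly_Mapping.lookup m' j) * Poly_Mapping.lookup P m')) (m - ?e))"
    by (rule sum.mono_neutral_right) (use assms(2) other in auto)
  finally show ?thesis by simp
qed simp

lemma partial_deriv_superset:
  assumes "finite S" "Poly_Mapping.keys P \<subseteq> S"
  shows "partial_deriv j P = (\<Sum>m\<in>S. Poly_Mapping.single (m - Poly_Mapping.single j 1)
       (of_nat (Poly_Mapping.lookup m j) * Poly_Mapping.lookup P m))"
  unfolding partial_deriv_def
  by (rule sum.mono_neutral_left) (use assms in \<open>auto simp: in_keys_iff\<close>)

lemma partial_deriv_add: "partial_deriv j (P + Q) = partial_deriv j P + partial_deriv j Q"
proof -
  let ?S = "Poly_Mapping.keys P \<union> Poly_Mapping.keys Q"
  show ?thesis
    using Poly_Mapping.keys_add[of P Q]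
    by (simp add: partial_deriv_superset[of ?S] lookup_add distrib_left single_add sum.distrib)
qed

lemma partial_deriv_diff: "partial_deriv j (P - Q) = partial_deriv j P - partial_deriv j Q"
  using partial_deriv_add[of j "P - Q" Q] by simp

lemma partial_deriv_single:
  "partial_deriv j (Poly_Mapping.single m c) = 
     Poly_Mapping.single (m - Poly_Mapping.single j 1) (of_nat (Poly_Mapping.lookup m j) * c)"
  by (subst partial_deriv_superset[of "{m}"]) auto

lemma partial_deriv_Var: "partial_deriv j (Var i) = (if i = j then 1 else 0)"
  by (auto simp: Var_def partial_deriv_single lookup_single when_def single_one)

section \<open>The shape of low-degree perturbations\<close>

text \<open>
  Dividing exponents by \<open>p\<close> is harmless since \<open>x \<mapsto> x ^ p\<close> permutes the finite field.  The divided
  monomials have degree at most \<open>q\<close>, so the reduction \<open>X\<^sub>j ^ q = X\<^sub>j\<close> identifies only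
  \<open>X\<^sub>j ^ q\<close> with \<open>X\<^sub>j\<close>; the coefficients of all other monomials must vanish.
\<close>

lemma vanishing_power_form:
  fixes H :: "'a::finite_field mpoly"
  assumes p: "prime p" and card: "CARD('a) = q" "q = p ^ e" and e: "e \<ge> 1"
    and H: "H \<in> polys_in n"
    and div: "\<And>m i. m \<in> Poly_Mapping.keys H \<Longrightarrow> p dvd Poly_Mapping.lookup m i"
    and deg: "\<And>m. m \<in> Poly_Mapping.keys H \<Longrightarrow> monomial_degree m < p * (q + 1)"
    and van: "\<And>y. eval_mpoly y H = 0"
  shows "Poly_Mapping.keys H \<subseteq> (\<lambda>j. Poly_Mapping.single j (p * q)) ` {1..n} \<union>
           (\<lambda>j. Poly_Mapping.single j p) ` {1..n}" (is "_ \<subseteq> ?A \<union> ?B")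
    and "\<And>j. j \<in> {1..n} \<Longrightarrow> Poly_Mapping.lookup H (Poly_Mapping.single j p) =
           - Poly_Mapping.lookup H (Poly_Mapping.single j (p * q))"
proof -
  let ?l = "Poly_Mapping.lookup"
  define k where "k m i = ?l m i div p" for m :: monomial and i
  \<comment> \<open>\<open>k m\<close> is the divided exponent vector and \<open>r m\<close> its
    reduction modulo X_i^q = X_i. Because of the bound \<open>kle\<close> below, q is the only
    exponent that needs reducing.\<close>
  define r where "r m = (\<lambda>i\<in>{1..n}. if k m i = q then 1 else k m i)" for m
  have p1: "p > 1" using p by (rule prime_gt_1_nat)
  have q1: "q > 1" using p1 e unfolding card(2) by (intro one_less_power) auto
  have l: "?l m i = p * k m i" if "m \<in> Poly_Mapping.keys H" for m i
    using div[OF that, of i] by (simp add: k_def)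
  have kle: "k m i \<le> q" if "m \<in> Poly_Mapping.keys H" for m i
  proof -
    have "p * k m i < p * (q + 1)"
      using deg[OF that] lookup_le_monomial_degree[of m i] l[OF that, of i] by linarith
    then show ?thesis by (simp only: mult_less_cancel1) simp
  qed
  have k0: "k m i = 0" if "m \<in> Poly_Mapping.keys H" "i \<notin> {1..n}" for m i
  proof -
    have "i \<notin> Poly_Mapping.keys m" using polys_in_keys_subset[OF H] that by blast
    then show ?thesis by (simp add: k_def in_keys_iff)
  qed
  \<comment> \<open>An exponent p * q leaves less than p of the degree to any other variable, whose
    exponent is a multiple of p and hence 0.\<close>
  have big: "i \<in> {1..n} \<and> m = Poly_Mapping.single i (p * q)"
    if m: "m \<in> Poly_Mapping.keys H" and i: "k m i = q" for m i
  proof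
    show "i \<in> {1..n}" using k0[OF m] i q1 by force
    show "m = Poly_Mapping.single i (p * q)"
    proof (rule poly_mapping_eqI)
      fix j
      show "?l m j = ?l (Poly_Mapping.single i (p * q)) j"
      proof (cases "i = j")
        case False
        have "p * q + p * k m j < p * q + p * 1"
          using deg[OF m] lookup_add_lookup_le_monomial_degree[OF False, of m]
          unfolding l[OF m] i distrib_left by linarith
        then have "k m j < 1"
          by (simp only: add_less_cancel_left mult_less_cancel1)
        then show ?thesis using l[OF m, of j] False by (simp add: lookup_single)
      qed (use l[OF m] i in simp)
    qed
  qed
  have r_single: "r (Poly_Mapping.single j p) = (\<lambda>i\<in>{1..n}. if i = j then 1 else 0)"
      "r (Poly_Mapping.single j (p * q)) = (\<lambda>i\<in>{1..n}. if i = j then 1 else 0)" for j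
    using p1 q1 by (auto simp: r_def k_def lookup_single when_def fun_eq_iff)
  have fibre_single: "m = Poly_Mapping.single j p \<or> m = Poly_Mapping.single j (p * q)"
    if m: "m \<in> Poly_Mapping.keys H" and j: "j \<in> {1..n}" "r m = (\<lambda>i\<in>{1..n}. if i = j then 1 else 0)" for m j
  proof (cases "k m j = q")
    case True
    then show ?thesis using big m by blast
  next
    case False
    have r_eq: "r m i = (if i = j then 1 else 0)" if "i \<in> {1..n}" for i
      using j(2) that by simp
    have "k m j = 1" using r_eq[of j] j False by (simp add: r_def)
    moreover have "k m i = 0" if "i \<noteq> j" for i
      using r_eq[of i] k0[OF m, of i] that by (cases "i \<in> {1..n}") (auto simp: r_def split: if_splits)
    ultimately have "m = Poly_Mapping.single j p"
      using l[OF m] by (intro poly_mapping_eqI) (auto simp: lookup_single when_def)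
    then show ?thesis by simp
  qed
  \<comment> \<open>Away from the two families of pure powers the reduction is injective on the
    support, so each such coefficient is alone in its fibre.\<close>
  have fibre: "m' = m"
    if m: "m \<in> Poly_Mapping.keys H" "m \<notin> ?A \<union> ?B" and m': "m' \<in> Poly_Mapping.keys H" "r m' = r m" for m m'
  proof -
    have m_ne: "k m i \<noteq> q" for i using big[OF m(1)] m(2) by blast
    have m'_ne: "k m' i \<noteq> q" for i
    proof
      assume "k m' i = q"
      with big[OF m'(1)] have i: "i \<in> {1..n}" "m' = Poly_Mapping.single i (p * q)" by auto
      with m'(2) r_single have "r m = (\<lambda>j\<in>{1..n}. if j = i then 1 else 0)" by simp
      from fibre_single[OF m(1) i(1) this] m(2) i(1) show False by blast
    qed
    have "k m' i = k m i" for i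
    proof (cases "i \<in> {1..n}")
      case True
      then show ?thesis using fun_cong[OF m'(2), of i] m_ne m'_ne by (simp add: r_def)
    qed (simp add: k0 m(1) m'(1))
    then show "m' = m" by (intro poly_mapping_eqI) (simp add: l m(1) m'(1))
  qed
  have r_mem: "r m \<in> {1..n} \<rightarrow>\<^sub>E {..<q}" if "m \<in> Poly_Mapping.keys H" for m
    using kle[OF that] q1 by (auto simp: r_def le_neq_implies_less)
  \<comment> \<open>The sum over a fibre of \<open>r\<close> is a coefficient of the reduced
    polynomial, which vanishes everywhere.\<close>
  have fibre_sum: "(\<Sum>m\<in>{m \<in> Poly_Mapping.keys H. r m = f}. ?l H m) = 0"
    if "f \<in> {1..n} \<rightarrow>\<^sub>E {..<q}" for f
  proof (rule reduced_vanishing_imp_zero[where c = "\<lambda>f. \<Sum>m\<in>{m \<in> Poly_Mapping.keys H. r m = f}. ?l H m" and I = "{1..n}"])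
    fix z :: "nat \<Rightarrow> 'a"
    \<comment> \<open>This is the p-th root of \<open>z i\<close> in the field: its p-th power is (z
      i)^(p^e) = (z i)^q = z i.\<close>
    define y where "y i = z i ^ (p ^ (e - 1))" for i
    have zq: "t ^ q = t" for t :: 'a using finite_field_power_card_eq_same[of t] card by simp
    have y: "y i ^ p = z i" for i
      using zq[of "z i"] e card(2) by (simp add: y_def flip: power_mult power_Suc2)
    have zr: "z i ^ k m i = z i ^ r m i" if "i \<in> {1..n}" for m i
      using that zq by (simp add: r_def)
    have "0 = eval_mpoly y H" by (simp add: van)
    also have "\<dots> = (\<Sum>m\<in>Poly_Mapping.keys H. ?l H m * (\<Prod>i\<in>{1..n}. z i ^ r m i))"
      unfolding eval_mpoly_def
    proof (intro sum.cong refl arg_cong2[where f = "(*)"])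
      fix m assume m: "m \<in> Poly_Mapping.keys H"
      have "(\<Prod>i\<in>Poly_Mapping.keys m. y i ^ ?l m i) = (\<Prod>i\<in>{1..n}. y i ^ ?l m i)"
        by (rule prod_powers_superset) (use polys_in_keys_subset[OF H m] in simp_all)
      also have "\<dots> = (\<Prod>i\<in>{1..n}. z i ^ r m i)"
        by (rule prod.cong) (simp_all add: l[OF m] power_mult y zr)
      finally show "(\<Prod>i\<in>Poly_Mapping.keys m. y i ^ ?l m i) = (\<Prod>i\<in>{1..n}. z i ^ r m i)" .
    qed
    also have "\<dots> = (\<Sum>f\<in>{1..n} \<rightarrow>\<^sub>E {..<q}. \<Sum>m\<in>{m \<in> Poly_Mapping.keys H. r m = f}.
        ?l H m * (\<Prod>i\<in>{1..n}. z i ^ r m i))"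
      by (rule sum.group[symmetric]) (use r_mem in \<open>auto intro: finite_PiE\<close>)
    also have "\<dots> = (\<Sum>f\<in>{1..n} \<rightarrow>\<^sub>E {..<q}.
        (\<Sum>m\<in>{m \<in> Poly_Mapping.keys H. r m = f}. ?l H m) * (\<Prod>i\<in>{1..n}. z i ^ f i))"
      unfolding sum_distrib_right by (intro sum.cong refl) auto
    finally show "(\<Sum>f\<in>{1..n} \<rightarrow>\<^sub>E {..<CARD('a)}.
        (\<Sum>m\<in>{m \<in> Poly_Mapping.keys H. r m = f}. ?l H m) * (\<Prod>i\<in>{1..n}. z i ^ f i)) = 0"
      using card by simp
  qed (use that card in simp_all)
  show "Poly_Mapping.keys H \<subseteq> ?A \<union> ?B"
  proof (rule ccontr)
    assume "\<not> ?thesis"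
    then obtain m where m: "m \<in> Poly_Mapping.keys H" "m \<notin> ?A \<union> ?B" by blast
    have "{m' \<in> Poly_Mapping.keys H. r m' = r m} = {m}"
      using fibre[OF m] m(1) by blast
    with fibre_sum[OF r_mem[OF m(1)]] m(1) show False by (simp add: in_keys_iff)
  qed
  show "?l H (Poly_Mapping.single j p) = - ?l H (Poly_Mapping.single j (p * q))"
    if j: "j \<in> {1..n}" for j
  proof -
    define f where "f = (\<lambda>i\<in>{1..n}. if i = j then 1 else 0 :: nat)"
    have ne: "Poly_Mapping.single j p \<noteq> Poly_Mapping.single j (p * q)"
    proof
      assume "Poly_Mapping.single j p = Poly_Mapping.single j (p * q)"
      from arg_cong[OF this, of "\<lambda>m. ?l m j"] show False using p1 q1 by simp
    qed
    have "0 = (\<Sum>m\<in>{m \<in> Poly_Mapping.keys H. r m = f}. ?l H m)"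
      by (rule fibre_sum[symmetric]) (use q1 in \<open>auto simp: f_def\<close>)
    \<comment> \<open>The fibre may contain only one of the two monomials, or neither; a missing one
      has coefficient 0.\<close>
    also have "\<dots> = (\<Sum>m\<in>{Poly_Mapping.single j p, Poly_Mapping.single j (p * q)}. ?l H m)"
      by (rule sum.mono_neutral_left)
         (use fibre_single j r_single in \<open>auto simp: f_def in_keys_iff\<close>)
    also have "\<dots> = ?l H (Poly_Mapping.single j p) + ?l H (Poly_Mapping.single j (p * q))"
      using ne by simp
    finally show ?thesis by (simp add: eq_neg_iff_add_eq_0)
  qed
qed

section \<open>Evaluation over the algebraic closure\<close>

text \<open>\<open>Poly_Mapping.map\<close> applies its function to nonzero coefficients only; this
  makes no difference because \<open>to_ac\<close> sends 0 to 0.\<close>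

lemma lookup_map_to_ac: "Poly_Mapping.lookup (Poly_Mapping.map to_ac P) m = to_ac (Poly_Mapping.lookup P m)"
  by (simp add: Poly_Mapping.map.rep_eq when_def)

lemma map_to_ac_add:
  "Poly_Mapping.map to_ac (P + Q) = Poly_Mapping.map to_ac P + Poly_Mapping.map to_ac Q"
  by (rule poly_mapping_eqI) (simp add: lookup_map_to_ac lookup_add)

lemma map_to_ac_diff:
  "Poly_Mapping.map to_ac (P - Q) = Poly_Mapping.map to_ac P - Poly_Mapping.map to_ac Q"
  using map_to_ac_add[of "P - Q" Q] by simp

lemma map_to_ac_Var: "Poly_Mapping.map to_ac (Var i) = Var i"
  by (simp add: Var_def)

text \<open>The shape found from values on the small field is a statement about coefficients. It
  therefore survives extension of scalars and gives a formula at every point over the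
  closure.\<close>

lemma eval_vanishing_power_form:
  fixes H :: "'a::finite_field mpoly"
  assumes "p > 0" "q > 1"
    and keys: "Poly_Mapping.keys H \<subseteq> (\<lambda>j. Poly_Mapping.single j (p * q)) ` {1..n} \<union>
           (\<lambda>j. Poly_Mapping.single j p) ` {1..n}" (is "_ \<subseteq> ?A \<union> ?B")
    and coeffs: "\<And>j. j \<in> {1..n} \<Longrightarrow> Poly_Mapping.lookup H (Poly_Mapping.single j p) =
           - Poly_Mapping.lookup H (Poly_Mapping.single j (p * q))"
  shows "eval_mpoly x (Poly_Mapping.map to_ac H) =
    (\<Sum>j\<in>{1..n}. to_ac (Poly_Mapping.lookup H (Poly_Mapping.single j (p * q))) * (x j ^ (p * q) - x j ^ p))"
proof -
  have inj: "inj_on (\<lambda>j. Poly_Mapping.single j k) {1..n}" if "k > 0" for k :: nat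
  proof (rule inj_onI)
    fix i j assume "Poly_Mapping.single i k = Poly_Mapping.single j k"
    from arg_cong[OF this, of Poly_Mapping.keys] show "i = j" using that by simp
  qed
  have disjoint: "?A \<inter> ?B = {}"
  proof (rule ccontr)
    assume "?A \<inter> ?B \<noteq> {}"
    then obtain i j :: nat where eq: "Poly_Mapping.single i (p * q) = Poly_Mapping.single j p" by auto
    from arg_cong[OF eq, of Poly_Mapping.keys] have "i = j" using assms(1,2) by simp
    with arg_cong[OF eq, of "\<lambda>m. Poly_Mapping.lookup m i"] show False using assms(1,2) by simp
  qed
  have "Poly_Mapping.keys (Poly_Mapping.map to_ac H) \<subseteq> ?A \<union> ?B"
    using keys by (auto simp: in_keys_iff lookup_map_to_ac subset_iff)
  then have "eval_mpoly x (Poly_Mapping.map to_ac H) =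
      (\<Sum>m\<in>?A \<union> ?B. to_ac (Poly_Mapping.lookup H m) *
         (\<Prod>i\<in>Poly_Mapping.keys m. x i ^ Poly_Mapping.lookup m i))"
    by (subst eval_mpoly_superset[of "?A \<union> ?B"]) (simp_all add: lookup_map_to_ac)
  also have "\<dots> = (\<Sum>j\<in>{1..n}. to_ac (Poly_Mapping.lookup H (Poly_Mapping.single j (p * q))) * x j ^ (p * q)) +
      (\<Sum>j\<in>{1..n}. to_ac (Poly_Mapping.lookup H (Poly_Mapping.single j p)) * x j ^ p)"
    using assms(1,2) by (subst sum.union_disjoint[OF _ _ disjoint]) (simp_all add: sum.reindex inj del: One_nat_def)
  also have "\<dots> = (\<Sum>j\<in>{1..n}. to_ac (Poly_Mapping.lookup H (Poly_Mapping.single j (p * q))) *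
      (x j ^ (p * q) - x j ^ p))"
    unfolding sum.distrib[symmetric]
    by (rule sum.cong) (simp_all add: coeffs right_diff_distrib)
  finally show ?thesis .
qed

section \<open>Systems of equations under Frobenius\<close>

text \<open>Together with the next three lemmas, this lets \<open>frob_diff\<close> pass through
  sums, signs, p-th powers and coefficients fixed by the q-Frobenius, hence through the whole system
  below.\<close>

lemma frob_diff_sum:
  fixes f :: "'b \<Rightarrow> 'a::comm_ring_1"
  assumes "prime CHAR('a)" "q = CHAR('a) ^ e"
  shows "frob_diff q (\<Sum>j\<in>A. f j) = (\<Sum>j\<in>A. frob_diff q (f j))"
  unfolding frob_diff_def
  by (subst freshmans_dream_sum'[OF assms]) (simp add: sum_subtractf)

lemma frob_diff_uminus:
  fixes u :: "'a::comm_ring_1"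
  assumes "prime CHAR('a)" "q = CHAR('a) ^ e"
  shows "frob_diff q (- u) = - frob_diff q u"
proof -
  have "CHAR('a) ^ e > 0" using assms(1) by (simp add: prime_gt_0_nat)
  then show ?thesis
    using diff_power_prime_power[OF assms(1), of 0 u e] by (simp add: frob_diff_def assms(2) power_0_left)
qed

lemma frob_diff_power_char:
  fixes u :: "'a::comm_ring_1"
  assumes "prime CHAR('a)"
  shows "frob_diff q (u ^ CHAR('a)) = frob_diff q u ^ CHAR('a)"
  using diff_power_prime_power[OF assms, of "u ^ q" u 1]
  by (simp add: frob_diff_def mult.commute flip: power_mult)

lemma frob_diff_scale: "b ^ q = b \<Longrightarrow> frob_diff q (b * u) = b * frob_diff q u"
  by (simp add: frob_diff_def power_mult_distrib right_diff_distrib)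

text \<open>
  Applying the operator \<open>frob_diff q\<close> to the system expresses its \<open>k\<close>-th iterate on \<open>z\<close> through
  the \<open>k + 1\<close>-st one, and the \<open>p ^ r\<close>-th iterate is zero.
\<close>

lemma frob_system_trivial_kernel:
  fixes z :: "nat \<Rightarrow> 'a::comm_ring_1"
  assumes p: "prime p" "CHAR('a) = p" and q: "q = p ^ e"
    and b: "\<And>i j. b i j ^ q = b i j"
    and fixed: "\<And>i. i \<in> I \<Longrightarrow> z i ^ (q ^ (p ^ r)) = z i"
    and sys: "\<And>i. i \<in> I \<Longrightarrow> z i + (\<Sum>j\<in>I. b i j * (z j ^ (p * q) - z j ^ p)) = 0"
    and i: "i \<in> I"
  shows "z i = 0"
proof -
  note pq = p(1)[folded p(2)] q[folded p(2)]
  define Z where "Z k i = (frob_diff q ^^ k) (z i)" for k i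
  have step: "Z k i = - (\<Sum>j\<in>I. b i j * Z (Suc k) j ^ p)" if "i \<in> I" for k i
    using that
  proof (induction k)
    case 0
    \<comment> \<open>This identifies the given system with the case k = 0 of the recursion.\<close>
    have "frob_diff q u ^ p = u ^ (p * q) - u ^ p" for u :: 'a
      using frob_diff_power_char[OF pq(1), of q u] p(2) by (simp add: frob_diff_def power_mult)
    then show ?case
      using sys[OF 0] by (simp add: Z_def eq_neg_iff_add_eq_0)
  next
    case (Suc k)
    have "Z (Suc k) i = frob_diff q (- (\<Sum>j\<in>I. b i j * Z (Suc k) j ^ p))"
      using Suc by (simp add: Z_def)
    also have "\<dots> = - (\<Sum>j\<in>I. b i j * Z (Suc (Suc k)) j ^ p)"
      using frob_diff_power_char[OF pq(1)] p(2)
      by (simp add: frob_diff_uminus[OF pq] frob_diff_sum[OF pq] frob_diff_scale[OF b] Z_def)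
    finally show ?case .
  qed
  have p0: "p > 0" using p(1) by (rule prime_gt_0_nat)
  \<comment> \<open>Descent from the vanishing iterate p^r to iterate 0. Truncated subtraction makes
    the claim for larger \<open>k\<close> repeat the one for k = p^r.\<close>
  have "\<forall>i\<in>I. Z (p ^ r - k) i = 0" for k
  proof (induction k)
    case 0
    show ?case
      using frob_diff_funpow_prime_power[OF pq, of r] fixed p(2) by (simp add: Z_def)
  next
    case (Suc k)
    show ?case
    proof (cases "k < p ^ r")
      case True
      then have "Suc (p ^ r - Suc k) = p ^ r - k" by simp
      then show ?thesis
        using Suc p0 by (simp add: step[where k = "p ^ r - Suc k"] power_0_left)
    next
      case False
      then show ?thesis using Suc by simp
    qed
  qed
  from this[of "p ^ r"] show ?thesis using i by (simp add: Z_def)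
qed

section \<open>Low-degree maps and their spectrum\<close>

lemma ext_field_add:
  fixes x y :: "'a::finite_field alg_closure"
  assumes "prime p" "CARD('a) = p ^ e" "x \<in> ext_field m" "y \<in> ext_field m"
  shows "x + y \<in> ext_field m"
  using ext_field_diff[OF assms(1,2,3) ext_field_diff[OF assms(1,2) ext_field_0 assms(4)]] by simp

lemma ext_field_sum:
  fixes f :: "'b \<Rightarrow> 'a::finite_field alg_closure"
  assumes "prime p" "CARD('a) = p ^ e" "\<And>j. j \<in> A \<Longrightarrow> f j \<in> ext_field m"
  shows "(\<Sum>j\<in>A. f j) \<in> ext_field m"
  using assms(3)
  by (induction A rule: infinite_finite_induct) (auto intro: ext_field_0 ext_field_add[OF assms(1,2)])

lemma ext_field_power: "x \<in> ext_field m \<Longrightarrow> x ^ k \<in> ext_field m"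
  by (induction k) (auto intro: ext_field_1 ext_field_mult)

lemma finite_ext_field: "m > 0 \<Longrightarrow> finite (ext_field m :: 'a::finite_field alg_closure set)"
  using card_ext_field[of m, where 'a = 'a] by (intro card_ge_0_finite) simp

text \<open>The identity Jacobian kills all partial derivatives of F_i - X_i, so p divides its
  exponents. The identity on rational points makes it vanish there. With the degree bound,
  \<open>vanishing_power_form\<close> applies.\<close>

lemma N_class_low_degree_form:
  fixes F :: "nat \<Rightarrow> 'a::finite_field mpoly"
  assumes p: "prime p" and card: "CARD('a) = q" "q = p ^ e" and e: "e \<ge> 1"
    and F: "F \<in> N_class n" and deg: "map_degree n F < p * (q + 1)"
  obtains b :: "nat \<Rightarrow> nat \<Rightarrow> 'a" where
    "\<And>x i. i \<in> {1..n} \<Longrightarrow> eval_mpoly x (extend_scalars F i) =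
       x i + (\<Sum>j\<in>{1..n}. to_ac (b i j) * (x j ^ (p * q) - x j ^ p))"
proof
  let ?b = "\<lambda>i j. Poly_Mapping.lookup (F i - Var i) (Poly_Mapping.single j (p * q))"
  fix x i assume i: "i \<in> {1..n}"
  define H where "H = F i - Var i"
  have p1: "p > 1" using p by (rule prime_gt_1_nat)
  have q1: "q > 1" using p1 e unfolding card(2) by (intro one_less_power) auto
  have char: "CHAR('a) = p" using CHAR_eq_of_CARD[of p e] p card by simp
  have Fi: "F i \<in> polys_in n" using F i by (auto simp: N_class_def poly_maps_def)
  have H: "H \<in> polys_in n" unfolding H_def using Fi Var_in_polys_in[OF i] by (rule polys_in_diff)
  have div: "p dvd Poly_Mapping.lookup m j" if m: "m \<in> Poly_Mapping.keys H" for m j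
  proof (cases "j \<in> {1..n}")
    case True
    have "partial_deriv j (F i) = (if i = j then 1 else 0)"
      using F i True by (auto simp: N_class_def jacobian_def)
    then have "partial_deriv j H = 0" by (simp add: H_def partial_deriv_diff partial_deriv_Var)
    from of_nat_lookup_eq_0[OF this m] have "of_nat (Poly_Mapping.lookup m j) = (0 :: 'a)"
      using m by (simp add: in_keys_iff)
    then show ?thesis by (simp add: of_nat_eq_0_iff_char_dvd char)
  next
    case False
    then have "j \<notin> Poly_Mapping.keys m" using polys_in_keys_subset[OF H m] by blast
    then show ?thesis by (simp add: in_keys_iff)
  qed
  have H_deg: "monomial_degree m < p * (q + 1)" if m: "m \<in> Poly_Mapping.keys H" for m
  proof -
    \<comment> \<open>As p does not divide 1, the monomial X_i is absent from \<open>H\<close>.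
      Every monomial of \<open>H\<close> thus occurs in \<open>F i\<close> and inherits its degree
      bound.\<close>
    have "m \<noteq> Poly_Mapping.single i 1"
      using div[OF m, of i] p1 by auto
    then have "m \<in> Poly_Mapping.keys (F i)"
      using m by (auto simp: H_def in_keys_iff Var_def lookup_minus lookup_single when_def split: if_splits)
    then show ?thesis
      using monomial_degree_le_total_degree total_degree_le_map_degree[OF i, of F] deg
      by (meson le_less_trans)
  qed
  have van: "eval_mpoly y H = 0" for y
  proof -
    \<comment> \<open>Points of the affine space are extensional functions, whereas \<open>y\<close>
      is arbitrary outside {1..n}.\<close>
    have "restrict y {1..n} \<in> {1..n} \<rightarrow>\<^sub>E UNIV" by simp
    then have "eval_map n F (restrict y {1..n}) = restrict y {1..n}"
      using F unfolding N_class_def by blast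
    from fun_cong[OF this, of i] have "eval_mpoly (restrict y {1..n}) (F i) = y i"
      using i by (simp add: eval_map_def)
    moreover have "eval_mpoly (restrict y {1..n}) (F i) = eval_mpoly y (F i)"
      by (rule eval_mpoly_cong[OF Fi]) simp
    ultimately show ?thesis by (simp add: H_def eval_mpoly_diff eval_mpoly_Var)
  qed
  note form = vanishing_power_form[OF p card e H div H_deg van]
  have "eval_mpoly x (Poly_Mapping.map to_ac H) = eval_mpoly x (extend_scalars F i) - x i"
    by (simp add: H_def map_to_ac_diff eval_mpoly_diff map_to_ac_Var eval_mpoly_Var extend_scalars_def)
  moreover have "eval_mpoly x (Poly_Mapping.map to_ac H) =
      (\<Sum>j\<in>{1..n}. to_ac (?b i j) * (x j ^ (p * q) - x j ^ p))"
    unfolding H_def[symmetric] using p1 q1 form by (intro eval_vanishing_power_form) auto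
  ultimately show "eval_mpoly x (extend_scalars F i) =
      x i + (\<Sum>j\<in>{1..n}. to_ac (?b i j) * (x j ^ (p * q) - x j ^ p))"
    by (simp add: algebra_simps)
qed

text \<open>The explicit form is additive, so injectivity reduces to a trivial kernel, which
  \<open>frob_system_trivial_kernel\<close> supplies. An injective self-map of a finite set is
  bijective.\<close>

lemma prime_power_in_spectrum:
  fixes F :: "nat \<Rightarrow> 'a::finite_field mpoly"
  assumes p: "prime p" and card: "CARD('a) = q" "q = p ^ e" and e: "e \<ge> 1"
    and F: "F \<in> N_class n" and deg: "map_degree n F < p * (q + 1)"
  shows "p ^ r \<in> spectrum n F"
proof -
  obtain b :: "nat \<Rightarrow> nat \<Rightarrow> 'a" where form:
    "\<And>x i. i \<in> {1..n} \<Longrightarrow> eval_mpoly x (extend_scalars F i) =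
       x i + (\<Sum>j\<in>{1..n}. to_ac (b i j) * (x j ^ (p * q) - x j ^ p))"
    using N_class_low_degree_form[OF assms] by blast
  let ?K = "ext_field (p ^ r) :: 'a alg_closure set"
  let ?S = "{1..n} \<rightarrow>\<^sub>E ?K"
  let ?f = "eval_map n (extend_scalars F)"
  have pr: "p ^ r > 0" using p by (simp add: prime_gt_0_nat)
  have card': "CARD('a) = p ^ e" using card by simp
  have char: "CHAR('a alg_closure) = p" using CHAR_eq_of_CARD[OF p card'] by simp
  have f: "?f x i = x i + (\<Sum>j\<in>{1..n}. to_ac (b i j) * (x j ^ (p * q) - x j ^ p))"
    if "i \<in> {1..n}" for x i using that by (simp add: eval_map_def form)
  have maps: "?f ` ?S \<subseteq> ?S"
  proof clarify
    fix x assume x: "x \<in> ?S"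
    have "?f x i \<in> ?K" if "i \<in> {1..n}" for i
      unfolding f[OF that]
      by (intro ext_field_add[OF p card'] ext_field_sum[OF p card'] ext_field_mult
          ext_field_diff[OF p card'] ext_field_power to_ac_in_ext_field)
         (use x that in auto)
    then show "?f x \<in> ?S" by (simp add: eval_map_def)
  qed
  have inj: "inj_on ?f ?S"
  proof (rule inj_onI)
    fix x y assume x: "x \<in> ?S" and y: "y \<in> ?S" and eq: "?f x = ?f y"
    define z where "z i = x i - y i" for i
    \<comment> \<open>Both exponents are powers of the characteristic: p * q = p^(e+1) and p =
      p^1.\<close>
    have diff: "z j ^ (p * q) = x j ^ (p * q) - y j ^ (p * q)" "z j ^ p = x j ^ p - y j ^ p" for j
      using diff_power_prime_power[of "x j" "y j" "Suc e"] diff_power_prime_power[of "x j" "y j" 1]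
        p char card(2) by (simp_all add: z_def)
    have "z i = 0" if i: "i \<in> {1..n}" for i
    proof (rule frob_system_trivial_kernel[OF p char card(2) _ _ _ i, where b = "\<lambda>i j. to_ac (b i j)"])
      show "to_ac (b i j) ^ q = to_ac (b i j)" for i j
        using finite_field_power_card_eq_same[of "b i j"] card(1) by (simp flip: to_ac_power)
      show "z i ^ (q ^ p ^ r) = z i" if "i \<in> {1..n}" for i
      proof -
        have "z i \<in> ?K"
          unfolding z_def by (rule ext_field_diff[OF p card']) (use x y that in auto)
        then show ?thesis by (simp add: ext_field_def card(1))
      qed
      show "z i + (\<Sum>j\<in>{1..n}. to_ac (b i j) * (z j ^ (p * q) - z j ^ p)) = 0" if "i \<in> {1..n}" for i
      proof -
        have "z i + (\<Sum>j\<in>{1..n}. to_ac (b i j) * (z j ^ (p * q) - z j ^ p)) = ?f x i - ?f y i"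
          unfolding f[OF that] diff
          by (simp add: z_def right_diff_distrib sum_subtractf)
        then show ?thesis by (simp add: eq)
      qed
    qed
    then show "x = y"
      using x y by (intro PiE_ext) (auto simp: z_def)
  qed
  have "finite ?S" using finite_ext_field[OF pr] by (intro finite_PiE) auto
  then have "bij_betw ?f ?S ?S"
    using inj maps by (simp add: bij_betw_def endo_inj_surj)
  then show ?thesis using pr by (simp add: spectrum_def)
qed

lemma N_class_low_degree_extension_exceptional:
  fixes F :: "nat \<Rightarrow> 'a::finite_field mpoly"
  assumes p: "prime p" and "CARD('a) = q" "q = p ^ e" "e \<ge> 1"
    and "F \<in> N_class n" "map_degree n F < p * (q + 1)"
  shows "extension_exceptional n F"
proof -
  have "inj (\<lambda>r. p ^ r)"
    using prime_gt_1_nat[OF p] by (simp add: inj_on_def)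
  then have "infinite (range (\<lambda>r. p ^ r))" by (simp add: finite_image_iff)
  moreover have "range (\<lambda>r. p ^ r) \<subseteq> spectrum n F"
    using prime_power_in_spectrum[OF assms] by blast
  ultimately show ?thesis
    unfolding extension_exceptional_def using infinite_super by blast
qed

section \<open>The extremal map\<close>

text \<open>The constant coefficient detects whether a natural number vanishes. This makes
  additivity of p-th powers available for polynomials.\<close>

lemma CHAR_mpoly: "CHAR('a::comm_ring_1 mpoly) = CHAR('a)"
proof (rule CHAR_eqI)
  show "of_nat CHAR('a) = (0 :: 'a mpoly)"
    by (simp flip: single_of_nat)
  show "CHAR('a) dvd k" if "of_nat k = (0 :: 'a mpoly)" for k
    using arg_cong[OF that, of "\<lambda>P. Poly_Mapping.lookup P 0"]
    by (simp add: of_nat_eq_0_iff_char_dvd flip: single_of_nat)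
qed

lemma Var_power: "Var i ^ k = Poly_Mapping.single (Poly_Mapping.single i k) (1 :: 'a::comm_ring_1)"
  by (induction k) (simp_all add: Var_def mult_single single_one flip: single_add)

definition monomial12 :: "nat \<Rightarrow> nat \<Rightarrow> monomial" where
  "monomial12 a b = Poly_Mapping.single 1 a + Poly_Mapping.single 2 b"

lemma lookup_monomial12:
  "Poly_Mapping.lookup (monomial12 a b) i = (if i = 1 then a else if i = 2 then b else 0)"
  by (simp add: monomial12_def lookup_add lookup_single)

lemma keys_monomial12: "Poly_Mapping.keys (monomial12 a b) \<subseteq> {1, 2}"
  by (auto simp: in_keys_iff lookup_monomial12 split: if_splits)

lemma monomial_degree_monomial12: "monomial_degree (monomial12 a b) = a + b"
  by (subst monomial_degree_superset[OF _ keys_monomial12]) (simp_all add: lookup_monomial12)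

lemma eval_mpoly_single_monomial12:
  "eval_mpoly x (Poly_Mapping.single (monomial12 a b) c) = c * (x 1 ^ a * x 2 ^ b)"
  unfolding eval_mpoly_single
  by (subst prod_powers_superset[OF _ keys_monomial12]) (simp_all add: lookup_monomial12)

text \<open>Additivity of the p-th power expands the perturbation into just two monomials, from
  which derivatives and degree can be read off.\<close>

lemma extremal_map_1:
  assumes "prime p" "CHAR('a::comm_ring_1) = p" "n \<ge> 1"
  shows "(extremal_map p q n :: nat \<Rightarrow> 'a mpoly) 1 = Var 1 +
    (Poly_Mapping.single (monomial12 (p * q) p) 1 - Poly_Mapping.single (monomial12 p p) 1)"
proof -
  have "(Var 2 * (Var 1 ^ q - Var 1)) ^ p = (Var 2 ^ p * Var 1 ^ (p * q) - Var 2 ^ p * Var 1 ^ p :: 'a mpoly)"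
    using diff_power_prime_power[where 'a = "'a mpoly", of "Var 1 ^ q" "Var 1" 1] assms(1,2)
    unfolding power_mult_distrib CHAR_mpoly
    by (simp add: right_diff_distrib mult.commute[of p q] power_mult)
  also have "\<dots> = Poly_Mapping.single (monomial12 (p * q) p) 1 - Poly_Mapping.single (monomial12 p p) 1"
    by (simp add: Var_power mult_single monomial12_def add.commute)
  finally show ?thesis using assms(3) by (simp add: extremal_map_def)
qed

lemma extremal_map_other: "i \<in> {1..n} \<Longrightarrow> i \<noteq> 1 \<Longrightarrow> extremal_map p q n i = Var i"
  by (simp add: extremal_map_def)

lemma eval_extremal_map_1:
  fixes x :: "nat \<Rightarrow> 'a::comm_ring_1"
  assumes "prime p" "CHAR('a) = p" "n \<ge> 1"
  shows "eval_mpoly x (extremal_map p q n 1) = x 1 + x 2 ^ p * (x 1 ^ q - x 1) ^ p"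
proof -
  have "(x 1 ^ q - x 1) ^ p = x 1 ^ (p * q) - x 1 ^ p"
    using diff_power_prime_power[of "x 1 ^ q" "x 1" 1] assms(1,2)
    by (simp add: mult.commute flip: power_mult)
  then show ?thesis
    by (simp add: extremal_map_1[OF assms] eval_mpoly_add eval_mpoly_diff eval_mpoly_Var
        eval_mpoly_single_monomial12 right_diff_distrib mult.commute del: One_nat_def)
qed

lemma eval_map_extremal_map:
  fixes x :: "nat \<Rightarrow> 'a::comm_ring_1"
  assumes "prime p" "CHAR('a) = p" "n \<ge> 1"
  shows "eval_map n (extremal_map p q n) x =
    (\<lambda>i\<in>{1..n}. if i = 1 then x 1 + x 2 ^ p * (x 1 ^ q - x 1) ^ p else x i)"
  using eval_extremal_map_1[OF assms]
  by (auto simp: eval_map_def fun_eq_iff eval_mpoly_Var extremal_map_other simp del: One_nat_def)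

lemma extremal_map_in_N_class:
  assumes p: "prime p" and q: "CARD('a::finite_field) = q" and char: "CHAR('a) = p" and n: "n \<ge> 2"
  shows "(extremal_map p q n :: nat \<Rightarrow> 'a mpoly) \<in> N_class n"
proof -
  let ?F = "extremal_map p q n :: nat \<Rightarrow> 'a mpoly"
  have n1: "n \<ge> 1" using n by simp
  note F1 = extremal_map_1[OF p char n1]
  have single_in: "Poly_Mapping.single (monomial12 a b) c \<in> polys_in n" for a b and c :: 'a
    using keys_monomial12[of a b] n by (auto simp: polys_in_def)
  have "?F 1 \<in> polys_in n"
  proof -
    \<comment> \<open>The sum is regrouped into differences so that closure of
      \<open>polys_in\<close> under subtraction suffices.\<close>
    have "Var 1 - (Poly_Mapping.single (monomial12 p p) 1 - Poly_Mapping.single (monomial12 (p * q) p) 1)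
        \<in> (polys_in n :: 'a mpoly set)"
      using n by (intro polys_in_diff single_in Var_in_polys_in) auto
    then show ?thesis by (simp add: F1 algebra_simps del: One_nat_def)
  qed
  then have "?F i \<in> polys_in n" if "i \<in> {1..n}" for i
    using that Var_in_polys_in[OF that]
    by (cases "i = 1") (simp_all add: extremal_map_other del: One_nat_def)
  then have "?F \<in> poly_maps n"
    by (auto simp: poly_maps_def PiE_iff extremal_map_def)
  moreover have "jacobian ?F i j = (if i = j then 1 else 0)" if "i \<in> {1..n}" for i j
  proof (cases "i = 1")
    case True
    \<comment> \<open>The exponents of X_1 and X_2 are multiples of p, and every other variable has
      exponent 0.\<close>
    have "partial_deriv j (Poly_Mapping.single (monomial12 a p) 1 :: 'a mpoly) = 0" if "p dvd a" for a
      using that char by (auto simp: partial_deriv_single lookup_monomial12 of_nat_eq_0_iff_char_dvd)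
    then show ?thesis
      by (simp add: True jacobian_def F1[unfolded One_nat_def] partial_deriv_add partial_deriv_diff partial_deriv_Var)
  next
    case False
    then show ?thesis using that
      by (simp add: jacobian_def extremal_map_other partial_deriv_Var)
  qed
  moreover have "eval_map n ?F x = x" if "x \<in> {1..n} \<rightarrow>\<^sub>E UNIV" for x
  proof -
    have "t ^ q = t" for t :: 'a using finite_field_power_card_eq_same[of t] q by simp
    then show ?thesis using that prime_gt_0_nat[OF p]
      by (auto simp: eval_map_extremal_map[OF p char n1] fun_eq_iff PiE_iff extensional_def power_0_left)
  qed
  ultimately show ?thesis by (auto simp: N_class_def)
qed

lemma total_degree_Var: "total_degree (Var i :: 'a::comm_ring_1 mpoly) = 1"
  by (simp add: total_degree_def Var_def monomial_degree_def)

lemma map_degree_extremal_map: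
  assumes p: "prime p" and char: "CHAR('a::comm_ring_1) = p" and q: "q > 1" and n: "n \<ge> 2"
  shows "map_degree n (extremal_map p q n :: nat \<Rightarrow> 'a mpoly) = p * (q + 1)"
proof -
  let ?F = "extremal_map p q n :: nat \<Rightarrow> 'a mpoly"
  have n1: "n \<ge> 1" using n by simp
  note F1 = extremal_map_1[OF p char n1]
  have p1: "p > 1" using p by (rule prime_gt_1_nat)
  \<comment> \<open>The monomial of top degree differs from the other two, so its coefficient 1
    cannot cancel.\<close>
  have ne: "monomial12 (p * q) p \<noteq> monomial12 p p" "monomial12 (p * q) p \<noteq> Poly_Mapping.single 1 1"
  proof -
    have "Poly_Mapping.lookup (monomial12 (p * q) p) 1 \<noteq> Poly_Mapping.lookup (monomial12 p p) 1"
      using p1 q by (simp add: lookup_monomial12)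
    then show "monomial12 (p * q) p \<noteq> monomial12 p p" by metis
    have "Poly_Mapping.lookup (monomial12 (p * q) p) 2 \<noteq> Poly_Mapping.lookup (Poly_Mapping.single (1 :: nat) (1 :: nat)) 2"
      using p1 by (simp add: lookup_monomial12 lookup_single)
    then show "monomial12 (p * q) p \<noteq> Poly_Mapping.single 1 1" by metis
  qed
  have deg: "monomial_degree (Poly_Mapping.single 1 1) = 1"
    by (simp add: monomial_degree_def)
  have "p * 1 \<le> p * q" using q by (intro mult_le_mono) auto
  then have pq: "p \<le> p * q" by simp
  have F1_degree: "total_degree (?F 1) = p * (q + 1)"
    unfolding total_degree_def
  proof (rule Max_eqI)
    have "Poly_Mapping.keys (?F 1) \<subseteq> {Poly_Mapping.single 1 1, monomial12 (p * q) p, monomial12 p p}"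
      by (auto simp: F1 Var_def in_keys_iff lookup_add lookup_minus lookup_single when_def
          simp del: One_nat_def split: if_splits)
    then have "monomial_degree m \<in> {1, p * q + p, p + p}" if "m \<in> Poly_Mapping.keys (?F 1)" for m
      using that deg by (auto simp: monomial_degree_monomial12)
    then show "d \<le> p * (q + 1)" if "d \<in> insert 0 (monomial_degree ` Poly_Mapping.keys (?F 1))" for d
      using that p1 pq by fastforce
    have "Poly_Mapping.lookup (?F 1) (monomial12 (p * q) p) = 1"
      using ne ne[symmetric]
      by (simp add: F1 Var_def lookup_add lookup_minus lookup_single when_def del: One_nat_def)
    then have "monomial12 (p * q) p \<in> Poly_Mapping.keys (?F 1)"
      by (simp add: in_keys_iff)
    then have "monomial_degree (monomial12 (p * q) p) \<in> monomial_degree ` Poly_Mapping.keys (?F 1)"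
      by (rule imageI)
    then show "p * (q + 1) \<in> insert 0 (monomial_degree ` Poly_Mapping.keys (?F 1))"
      by (simp add: monomial_degree_monomial12 algebra_simps)
  qed simp
  show ?thesis
    unfolding map_degree_def
  proof (rule Max_eqI)
    have "total_degree (?F i) \<le> p * (q + 1)" if "i \<in> {1..n}" for i
      using F1_degree that extremal_map_other[OF that, of p q, where 'a = 'a] p1
      by (cases "i = 1") (auto simp: total_degree_Var)
    then show "d \<le> p * (q + 1)" if "d \<in> (\<lambda>i. total_degree (?F i)) ` {1..n}" for d
      using that by blast
    show "p * (q + 1) \<in> (\<lambda>i. total_degree (?F i)) ` {1..n}"
      using F1_degree n1 by (intro image_eqI[of _ _ 1]) auto
  qed simp
qed

lemma extend_scalars_extremal_map:
  fixes i :: nat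
  assumes "prime p" "CHAR('a::finite_field) = p" "i \<in> {1..n}"
  shows "extend_scalars (extremal_map p q n :: nat \<Rightarrow> 'a mpoly) i = extremal_map p q n i"
proof (cases "i = 1")
  case True
  have n: "n \<ge> 1" using assms(3) by simp
  have char: "CHAR('a alg_closure) = p" using assms(2) by simp
  show ?thesis
    unfolding True extend_scalars_def extremal_map_1[OF assms(1,2) n] extremal_map_1[OF assms(1) char n]
    by (simp add: map_to_ac_add map_to_ac_diff map_to_ac_Var del: One_nat_def)
next
  case False
  then show ?thesis
    using assms(3) by (simp add: extend_scalars_def extremal_map_other map_to_ac_Var)
qed

lemma spectrum_extremal_map:
  assumes p: "prime p" and card: "CARD('a::finite_field) = q" "q = p ^ e" and e: "e \<ge> 1" and n: "n \<ge> 2"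
  shows "spectrum n (extremal_map p q n :: nat \<Rightarrow> 'a mpoly) = {1}"
proof -
  let ?F = "extremal_map p q n :: nat \<Rightarrow> 'a mpoly"
  let ?K = "\<lambda>m. ext_field m :: 'a alg_closure set"
  have n1: "n \<ge> 1" using n by simp
  have p1: "p > 1" using p by (rule prime_gt_1_nat)
  have q1: "q > 1" using p1 e unfolding card(2) by (intro one_less_power) auto
  have card': "CARD('a) = p ^ e" using card by simp
  have char: "CHAR('a) = p" using CHAR_eq_of_CARD[OF p card'] .
  then have char': "CHAR('a alg_closure) = p" by simp
  have f: "eval_map n (extend_scalars ?F) x =
      (\<lambda>i\<in>{1..n}. if i = 1 then x 1 + x 2 ^ p * (x 1 ^ q - x 1) ^ p else x i)" for x
  proof -
    have "eval_map n (extend_scalars ?F) x = eval_map n (extremal_map p q n) x"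
      using extend_scalars_extremal_map[OF p char] by (auto simp: eval_map_def fun_eq_iff)
    then show ?thesis by (simp add: eval_map_extremal_map[OF p char' n1])
  qed
  have "1 \<in> spectrum n ?F"
  proof -
    \<comment> \<open>On the field with q elements x_1^q - x_1 = 0, so the perturbation
      disappears.\<close>
    have "eval_map n (extend_scalars ?F) x = x" if "x \<in> {1..n} \<rightarrow>\<^sub>E ?K 1" for x
      using that n1 p1 by (auto simp: f fun_eq_iff PiE_iff extensional_def ext_field_def card(1) power_0_left)
    then have "bij_betw (eval_map n (extend_scalars ?F)) ({1..n} \<rightarrow>\<^sub>E ?K 1) ({1..n} \<rightarrow>\<^sub>E ?K 1)
        = bij_betw id ({1..n} \<rightarrow>\<^sub>E ?K 1) ({1..n} \<rightarrow>\<^sub>E ?K 1)"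
      by (intro bij_betw_cong) simp
    then show ?thesis by (simp add: spectrum_def)
  qed
  moreover have "m = 1" if m: "m \<in> spectrum n ?F" for m
  proof (rule ccontr)
    assume "m \<noteq> 1"
    with m have m2: "m > 1" by (simp add: spectrum_def)
    \<comment> \<open>A cardinality comparison provides an element \<open>u\<close> of the larger
      field that the q-Frobenius moves.\<close>
    have "card (?K 1) < card (?K m)"
      using m2 q1 by (simp add: card_ext_field card(1) power_strict_increasing[of 1 m q, simplified])
    moreover have "finite (?K 1)" by (rule finite_ext_field) simp
    ultimately have "\<not> ?K m \<subseteq> ?K 1" using card_mono by (meson not_less)
    then obtain u where u: "u \<in> ?K m" "u ^ q \<noteq> u"
      by (auto simp: ext_field_def card(1))
    \<comment> \<open>\<open>t\<close> is the \<open>p\<close>-th root of \<open>s\<close>, chosen such that \<open>u\<close> and \<open>0\<close> in the first coordinate collide.\<close>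
    define s where "s = (0 - u) * inverse ((u ^ q - u) ^ p)"
    define t where "t = s ^ (p ^ (e * m - 1))"
    have s: "s \<in> ?K m" unfolding s_def
      by (intro ext_field_mult ext_field_inverse ext_field_power ext_field_diff[OF p card'] ext_field_0 u)
    have t: "t \<in> ?K m" unfolding t_def using s by (rule ext_field_power)
    \<comment> \<open>Since q^m = p^(e m), the exponent p^(e m - 1) inverts the p-th power on this
      field; e m is positive, so the subtraction is not truncated.\<close>
    have "p ^ (e * m - 1) * p = p ^ (e * m)"
      using e m2 by (cases "e * m") auto
    then have "t ^ p = s ^ (q ^ m)"
      unfolding t_def card(2) by (simp flip: power_mult)
    also have "\<dots> = s" using s by (simp add: ext_field_def card(1))
    finally have "u + t ^ p * (u ^ q - u) ^ p = 0"
      using u(2) by (simp add: s_def)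
    moreover define x where "x = (\<lambda>i\<in>{1..n}. if i = 1 then u else if i = 2 then t else 0)"
    moreover define y where "y = (\<lambda>i\<in>{1..n}. if i = 2 then t else 0)"
    ultimately have "eval_map n (extend_scalars ?F) x = eval_map n (extend_scalars ?F) y"
      using n p1 q1 by (auto simp: f fun_eq_iff power_0_left)
    moreover have "x \<in> {1..n} \<rightarrow>\<^sub>E ?K m" "y \<in> {1..n} \<rightarrow>\<^sub>E ?K m"
      using u(1) t ext_field_0 by (auto simp: x_def y_def)
    moreover have "inj_on (eval_map n (extend_scalars ?F)) ({1..n} \<rightarrow>\<^sub>E ?K m)"
      using m by (simp add: spectrum_def bij_betw_def)
    ultimately have "x = y" by (simp add: inj_on_def)
    from fun_cong[OF this, of 1] have "u = 0" using n1 by (simp add: x_def y_def)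
    with u(2) q1 show False by (simp add: power_0_left)
  qed
  ultimately show ?thesis by blast
qed

theorem theorem5p8:
  fixes p e q n :: nat
  assumes "prime p" "e \<ge> 1" "q = p ^ e"
    and "CARD('a::finite_field) = q"
    and "n \<ge> 1"
  shows "(\<forall>F \<in> (N_class n :: (nat \<Rightarrow> 'a mpoly) set).
            map_degree n F < p * (q + 1) \<longrightarrow> extension_exceptional n F)
       \<and> (\<forall>F \<in> (N_class n :: (nat \<Rightarrow> 'a mpoly) set).
            finite (spectrum n F) \<longrightarrow> map_degree n F \<ge> p * (q + 1))
       \<and> (n \<ge> 2 \<longrightarrow>
            (extremal_map p q n :: nat \<Rightarrow> 'a mpoly) \<in> N_class n
          \<and> map_degree n (extremal_map p q n :: nat \<Rightarrow> 'a mpoly) = p * (q + 1)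
          \<and> spectrum n (extremal_map p q n :: nat \<Rightarrow> 'a mpoly) = {1})"
proof -
  have low: "extension_exceptional n F"
    if "F \<in> N_class n" "map_degree n F < p * (q + 1)" for F :: "nat \<Rightarrow> 'a mpoly"
    using N_class_low_degree_extension_exceptional[OF assms(1,4,3,2) that] .
  have "p > 1" using assms(1) by (rule prime_gt_1_nat)
  then have "q > 1" unfolding assms(3) using assms(2) by (intro one_less_power) auto
  moreover have "CHAR('a) = p" using CHAR_eq_of_CARD[of p e] assms(1,3,4) by simp
  \<comment> \<open>The lower bound for maps with finite spectrum is the contrapositive of
    \<open>low\<close>.\<close>
  ultimately show ?thesis
    using low extremal_map_in_N_class[OF assms(1,4)] map_degree_extremal_map[OF assms(1)]
      spectrum_extremal_map[OF assms(1,4,3,2)]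
    unfolding extension_exceptional_def by (auto simp: not_less[symmetric])
qed

end
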